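(* Let $f:\mathbb{R}^n\to\mathbb{R}^n$ be a polynomial map and let $\mathbb{X}\subset\mathbb{R}^n$ be a compact basic semialgebraic set, $\mathbb{X}=\{x\in\mathbb{R}^n : \varphi_0(x)\ge 0\}$ with $\varphi_0:\mathbb{R}^n\to\mathbb{R}^m$ a polynomial map. Suppose that $f$ has a (not necessarily unique) fixed point $\bar{x}=f(\bar{x})$ which is locally asymptotically stable for $x^+=f(x)$ with basin of attraction $\Psi$, that $\bar{x}$ lies in the interior of $\mathbb{X}$, and that $\mathbb{X}\subseteq\Psi$. For $X\subseteq\mathbb{R}^n$ put $F^{-1}_{\mathbb{X}}(X)=\{x\in\mathbb{X} : f(x)\in X\}$, and define $X_0=\mathbb{X}$ and $X_{k+1}=F^{-1}_{\mathbb{X}}(X_k)$ for all $k\in\mathbb{N}$. Then there exists a finite $k\in\mathbb{N}$ such that $X_{k+1}=F^{-1}_{\mathbb{X}}(X_k)=X_k$, and thus $X_k$ is the maximal positively invariant set for the dynamics $x^+=f(x)$ and the constraint set $\mathbb{X}$.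
   Context: $\mathbb{N}$ denotes the nonnegative integers. A map $g:\mathbb{R}^n\to\mathbb{R}^p$ is polynomial if each of its components is a polynomial in $n$ variables with real coefficients. Inequalities between vectors are componentwise. A set is basic semialgebraic if it is the solution set of a finite number of polynomial inequalities, i.e. of the form $\{x\in\mathbb{R}^n : \varphi(x)\ge 0\}$ for some polynomial map $\varphi:\mathbb{R}^n\to\mathbb{R}^p$. $f^k$ is the $k$-fold composition of $f$ with itself ($f^0$ the identity). A fixed point $\bar{x}$ is locally asymptotically stable if it is Lyapunov stable (for every $\epsilon>0$ there is $\delta>0$ such that $\|x-\bar{x}\|<\delta$ implies $\|f^k(x)-\bar{x}\|<\epsilon$ for all $k\in\mathbb{N}$) and locally attractive ($f^k(x)\to\bar{x}$ for all $x$ in some neighborhood of $\bar{x}$). Its basin of attraction is $\Psi=\{x\in\mathbb{R}^n : f^k(x)\to\bar{x}\text{ as }k\to\infty\}$. A set $\Omega\subseteq\mathbb{R}^n$ is positively invariant (for the dynamics $x^+=f(x)$ and constraint set $\mathbb{X}$) if $\Omega\subseteq\mathbb{X}$ and $f(x)\in\Omega$ for all $x\in\Omega$. The maximal positively invariant set is the positively invariant set that contains all positively invariant sets. *)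

theory Defs
  imports "HOL-Analysis.Analysis"
begin

definition lyapunov_stable :: "('a::real_normed_vector \<Rightarrow> 'a) \<Rightarrow> 'a \<Rightarrow> bool" where
  "lyapunov_stable f p \<longleftrightarrow>
     (\<forall>\<epsilon>>0. \<exists>\<delta>>0. \<forall>x. norm (x - p) < \<delta> \<longrightarrow> (\<forall>k::nat. norm ((f ^^ k) x - p) < \<epsilon>))"

definition locally_attractive :: "('a::real_normed_vector \<Rightarrow> 'a) \<Rightarrow> 'a \<Rightarrow> bool" where
  "locally_attractive f p \<longleftrightarrow> (\<forall>\<^sub>F x in nhds p. (\<lambda>k. (f ^^ k) x) \<longlonglongrightarrow> p)"

definition locally_asymptotically_stable ::
    "('a::real_normed_vector \<Rightarrow> 'a) \<Rightarrow> 'a \<Rightarrow> bool" where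
  "locally_asymptotically_stable f p \<longleftrightarrow> lyapunov_stable f p \<and> locally_attractive f p"

definition basin_of_attraction ::
    "('a::real_normed_vector \<Rightarrow> 'a) \<Rightarrow> 'a \<Rightarrow> 'a set" where
  "basin_of_attraction f p = {x. (\<lambda>k. (f ^^ k) x) \<longlonglongrightarrow> p}"

definition positively_invariant :: "('a \<Rightarrow> 'a) \<Rightarrow> 'a set \<Rightarrow> 'a set \<Rightarrow> bool" where
  "positively_invariant f X \<Omega> \<longleftrightarrow> \<Omega> \<subseteq> X \<and> (\<forall>x\<in>\<Omega>. f x \<in> \<Omega>)"

definition maximal_positively_invariant :: "('a \<Rightarrow> 'a) \<Rightarrow> 'a set \<Rightarrow> 'a set \<Rightarrow> bool" where
  "maximal_positively_invariant f X \<Omega> \<longleftrightarrow>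
     positively_invariant f X \<Omega> \<and> (\<forall>\<Omega>'. positively_invariant f X \<Omega>' \<longrightarrow> \<Omega>' \<subseteq> \<Omega>)"

definition constrained_preimage :: "('a \<Rightarrow> 'a) \<Rightarrow> 'a set \<Rightarrow> 'a set \<Rightarrow> 'a set" where
  "constrained_preimage f X S = {x \<in> X. f x \<in> S}"

primrec preimage_iterate :: "('a \<Rightarrow> 'a) \<Rightarrow> 'a set \<Rightarrow> nat \<Rightarrow> 'a set" where
  "preimage_iterate f X 0 = X"
| "preimage_iterate f X (Suc k) = constrained_preimage f X (preimage_iterate f X k)"

end

theory Submission
  imports Defs
begin

text \<open>
  The set \<open>X\<^sub>k\<close> consists of the points whose orbit stays in \<open>X\<close> for the first \<open>k\<close> steps, so the
  recursion can only fail to stabilise if orbits leave \<open>X\<close> for the first time after arbitrarily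
  many steps. Stability and compactness exclude this. Because the fixed point is interior to \<open>X\<close> and
  Lyapunov stable, it has an open neighbourhood \<open>V\<close> whose orbits never leave \<open>X\<close>
  (\<open>lyapunov_stable_trapping_ball\<close>). Every orbit starting in \<open>X\<close> converges to the fixed point and so
  enters \<open>V\<close>; by compactness of \<open>X\<close> and continuity of the iterates, all of them do so within a
  common number \<open>K\<close> of steps (\<open>compact_uniform_hitting_time\<close>). An orbit that stays in \<open>X\<close> for
  \<open>K\<close> steps has therefore met \<open>V\<close> and stays in \<open>X\<close> forever, whence \<open>X\<^sub>K = X\<^bsub>K+1\<^esub>\<close>
  (\<open>preimage_iterate_stationary\<close>). Since a positively invariant set lies in every
  iterate, a stationary iterate is the largest such set (\<open>stationary_iterate_maximal\<close>).
\<close>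

lemma mem_preimage_iterate_iff:
  "x \<in> preimage_iterate f X k \<longleftrightarrow> (\<forall>i\<le>k. (f ^^ i) x \<in> X)"
proof (induction k arbitrary: x)
  case 0
  then show ?case by simp
next
  case (Suc k)
  have "x \<in> preimage_iterate f X (Suc k) \<longleftrightarrow> x \<in> X \<and> (\<forall>i\<le>k. (f ^^ Suc i) x \<in> X)"
    by (simp add: constrained_preimage_def Suc.IH funpow_swap1)
  also have "\<dots> \<longleftrightarrow> (\<forall>i\<le>Suc k. (f ^^ i) x \<in> X)"
    by (metis Suc_le_mono funpow_0 le0 not0_implies_Suc)
  finally show ?case .
qed

lemma stationary_iterate_maximal:
  assumes "constrained_preimage f X (preimage_iterate f X k) = preimage_iterate f X k"
  shows "maximal_positively_invariant f X (preimage_iterate f X k)"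
proof -
  have "positively_invariant f X (preimage_iterate f X k)"
    using assms unfolding positively_invariant_def constrained_preimage_def by blast
  moreover have "\<Omega> \<subseteq> preimage_iterate f X k" if "positively_invariant f X \<Omega>" for \<Omega>
    using that
    by (induction k) (auto simp: positively_invariant_def constrained_preimage_def)
  ultimately show ?thesis
    unfolding maximal_positively_invariant_def by blast
qed

lemma preimage_iterate_stationary:
  assumes hit: "\<And>x. x \<in> X \<Longrightarrow> \<exists>i\<le>K. (f ^^ i) x \<in> V"
    and stay: "\<And>x j. x \<in> V \<Longrightarrow> (f ^^ j) x \<in> X"
  shows "preimage_iterate f X (Suc K) = preimage_iterate f X K"
proof -
  have "(f ^^ Suc K) x \<in> X" if x: "\<forall>i\<le>K. (f ^^ i) x \<in> X" for x
  proof -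
    have "x \<in> X"
      using x by (metis funpow_0 le0)
    then obtain i where i: "i \<le> K" "(f ^^ i) x \<in> V"
      using hit by blast
    have "(f ^^ (Suc K - i)) ((f ^^ i) x) \<in> X"
      using stay i(2) by blast
    moreover have "(f ^^ (Suc K - i)) ((f ^^ i) x) = (f ^^ (Suc K - i + i)) x"
      by (simp only: funpow_add o_apply)
    ultimately show ?thesis
      using i(1) by simp
  qed
  then show ?thesis
    unfolding set_eq_iff mem_preimage_iterate_iff by (metis le_Suc_eq)
qed

lemma lyapunov_stable_trapping_ball:
  assumes "lyapunov_stable f p" and "p \<in> interior X"
  obtains \<delta> where "\<delta> > 0" and "\<And>x k. x \<in> ball p \<delta> \<Longrightarrow> (f ^^ k) x \<in> X"
proof -
  obtain \<epsilon> where "\<epsilon> > 0" and \<epsilon>: "ball p \<epsilon> \<subseteq> X"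
    using assms(2) unfolding mem_interior by blast
  then obtain \<delta> where "\<delta> > 0"
    and "\<And>x k. norm (x - p) < \<delta> \<Longrightarrow> norm ((f ^^ k) x - p) < \<epsilon>"
    using assms(1) unfolding lyapunov_stable_def by blast
  then have "(f ^^ k) x \<in> X" if "x \<in> ball p \<delta>" for x k
    using that \<epsilon> by (auto simp: subset_iff dist_norm norm_minus_commute)
  with \<open>\<delta> > 0\<close> show thesis
    by (rule that)
qed

lemma continuous_on_funpow:
  fixes f :: "'a::topological_space \<Rightarrow> 'a"
  assumes "continuous_on UNIV f"
  shows "continuous_on UNIV (f ^^ k)"
proof (induction k)
  case 0
  then show ?case by (simp add: id_def)
next
  case (Suc k)
  then show ?case
    using continuous_on_compose continuous_on_subset [OF assms] by auto
qed

text \<open>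
  The points that are in \<open>V\<close> after exactly \<open>k\<close> steps form an open set. These sets cover \<open>X\<close>, and a
  finite subcover bounds the hitting times.
\<close>

lemma compact_uniform_hitting_time:
  fixes f :: "'a::topological_space \<Rightarrow> 'a"
  assumes "compact X" and "continuous_on UNIV f" and "open V"
    and hit: "\<And>x. x \<in> X \<Longrightarrow> \<exists>k. (f ^^ k) x \<in> V"
  obtains K where "\<And>x. x \<in> X \<Longrightarrow> \<exists>i\<le>K. (f ^^ i) x \<in> V"
proof -
  have "open ((f ^^ k) -` V)" for k
    using continuous_on_funpow [OF assms(2)] \<open>open V\<close> by (rule open_vimage [rotated])
  moreover have "X \<subseteq> (\<Union>k\<in>UNIV. (f ^^ k) -` V)"
    using hit by blast
  ultimately obtain I where "finite I" and I: "X \<subseteq> (\<Union>k\<in>I. (f ^^ k) -` V)"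
    using compactE_image [OF \<open>compact X\<close>, of UNIV "\<lambda>k. (f ^^ k) -` V"] by metis
  then have "\<forall>i\<in>I. i \<le> Max I"
    by simp
  with I have "\<exists>i\<le>Max I. (f ^^ i) x \<in> V" if "x \<in> X" for x
    using that by blast
  then show thesis
    by (rule that)
qed

theorem theorem11:
  fixes f :: "real ^ 'n \<Rightarrow> real ^ 'n"
    and \<phi>0 :: "real ^ 'n \<Rightarrow> real ^ 'm"
    and X :: "(real ^ 'n) set"
    and xbar :: "real ^ 'n"
  assumes "polynomial_function f"
    and "polynomial_function \<phi>0"
    and "X = {x. \<phi>0 x \<ge> 0}"
    and "compact X"
    and "f xbar = xbar"
    and "locally_asymptotically_stable f xbar"
    and "xbar \<in> interior X"
    and "X \<subseteq> basin_of_attraction f xbar"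
  shows "\<exists>k::nat.
      preimage_iterate f X (k + 1) = constrained_preimage f X (preimage_iterate f X k) \<and>
      constrained_preimage f X (preimage_iterate f X k) = preimage_iterate f X k \<and>
      maximal_positively_invariant f X (preimage_iterate f X k)"
proof -
  obtain \<delta> where "\<delta> > 0" and stay: "\<And>x k. x \<in> ball xbar \<delta> \<Longrightarrow> (f ^^ k) x \<in> X"
    using assms(6,7) lyapunov_stable_trapping_ball
    unfolding locally_asymptotically_stable_def by metis
  have "\<exists>k. (f ^^ k) x \<in> ball xbar \<delta>" if "x \<in> X" for x
  proof -
    have "(\<lambda>k. (f ^^ k) x) \<longlonglongrightarrow> xbar"
      using that assms(8) unfolding basin_of_attraction_def by blast
    then have "\<forall>\<^sub>F k in sequentially. (f ^^ k) x \<in> ball xbar \<delta>"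
      using \<open>\<delta> > 0\<close> by (intro topological_tendstoD) auto
    then show ?thesis
      unfolding eventually_sequentially by blast
  qed
  moreover have "continuous_on UNIV f"
    using assms(1) by (rule continuous_on_polymonial_function)
  ultimately obtain K where "\<And>x. x \<in> X \<Longrightarrow> \<exists>i\<le>K. (f ^^ i) x \<in> ball xbar \<delta>"
    using compact_uniform_hitting_time [OF assms(4) _ open_ball] by metis
  then have "preimage_iterate f X (Suc K) = preimage_iterate f X K"
    using stay by (rule preimage_iterate_stationary)
  then have fixed: "constrained_preimage f X (preimage_iterate f X K) = preimage_iterate f X K"
    by simp
  then show ?thesis
    using stationary_iterate_maximal [OF fixed] by auto
qed

end
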